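(* Let $(X,d)$ be a Hadamard space, let $m$ be a positive integer, and let $f : X \to (-\infty,+\infty]$ be defined by $f := \sum_{i=1}^m f_i$, where $f_i : X \to (-\infty,+\infty]$ is a proper lower semicontinuous convex function for all $i \in \{1,2,\dots,m\}$. Let $R_{\lambda_i,f_i} : X \to X$ be the resolvent operator of $f_i$ with respect to $\lambda_i > 0$ for all $i \in \{1,2,\dots,m\}$. If $\bigcap_{i=1}^m \operatorname{arg\,min}_X f_i \neq \emptyset$, then for any initial point $x_0 \in X$, the sequence defined for each $n \in \mathbb{N}$ by $$x_n := (R_{\lambda_m,f_m} R_{\lambda_{m-1},f_{m-1}} \cdots R_{\lambda_1,f_1})^n(x_0)$$ is $\Delta$-convergent to an element $x^\ast$ in $\operatorname{arg\,min}_X f$.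
   Context: A Hadamard space is a complete $\mathrm{CAT}(0)$ space. For $x,y \in X$ and $t \in [0,1]$, $(1-t)x \oplus ty$ denotes the point $\gamma(t)$, where $\gamma : [0,1] \to X$ is the unique geodesic with $\gamma(0)=x$, $\gamma(1)=y$, $d(\gamma(t),\gamma(s)) = d(x,y)|t-s|$. A function $g : X \to (-\infty,+\infty]$ is proper if $\{x \in X : g(x) < +\infty\} \ne \emptyset$; lower semicontinuous if $g(u) \le \liminf_{n} g(u_n)$ whenever $u_n \to u$; convex if $g((1-t)x \oplus ty) \le (1-t)g(x) + tg(y)$ for all $x,y\in X$, $t \in (0,1)$. $\operatorname{arg\,min}_X g$ is the set of minimizers of $g$ on $X$. For $\lambda > 0$ the resolvent of a proper lower semicontinuous convex function $g$ is $R_{\lambda,g}(x) = \operatorname{arg\,min}_{y \in X}\{ g(y) + \frac{1}{2\lambda} d(x,y)^2 \}$ for $x \in X$, which is well defined as a single-valued mapping $X \to X$. Products of mappings denote composition (rightmost applied first), and the power $n$ denotes the $n$-th iterate. For a bounded sequence $\{x_n\}$ in $X$, the asymptotic center is $\mathcal{A}(\{x_n\}) = \{ z \in X : \limsup_{n} d(z,x_n) = \inf_{y \in X} \limsup_{n} d(y,x_n)\}$ (a singleton in a Hadamard space). A bounded sequence $\{x_n\}$ is $\Delta$-convergent to $z \in X$ if $\mathcal{A}(\{x_{n_i}\}) = \{z\}$ for each subsequence $\{x_{n_i}\}$ of $\{x_n\}$. *)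

theory Defs
  imports "HOL-Analysis.Analysis"
begin

definition geodesic :: "(real \<Rightarrow> 'a::metric_space) \<Rightarrow> 'a \<Rightarrow> 'a \<Rightarrow> bool" where
  "geodesic \<gamma> x y \<longleftrightarrow> \<gamma> 0 = x \<and> \<gamma> 1 = y \<and>
     (\<forall>t\<in>{0..1}. \<forall>s\<in>{0..1}. dist (\<gamma> t) (\<gamma> s) = dist x y * \<bar>t - s\<bar>)"

definition comparison_triangle ::
  "'a::metric_space \<Rightarrow> 'a \<Rightarrow> 'a \<Rightarrow> real^2 \<Rightarrow> real^2 \<Rightarrow> real^2 \<Rightarrow> bool" where
  "comparison_triangle p q r p' q' r' \<longleftrightarrow>
     dist p' q' = dist p q \<and> dist q' r' = dist q r \<and> dist r' p' = dist r p"

text \<open>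
  All pairs of a point on the geodesic triangle with sides \<open>\<alpha>\<close> (from \<open>p\<close> to \<open>q\<close>), \<open>\<beta>\<close> (from \<open>q\<close> to
  \<open>r\<close>), \<open>\<gamma>\<close> (from \<open>r\<close> to \<open>p\<close>) and its comparison point on the corresponding side of the Euclidean
  triangle \<open>p'\<close>, \<open>q'\<close>, \<open>r'\<close>. Sides are parametrised proportionally to arc length, so the comparison
  point has the same parameter.
\<close>

definition comparison_points ::
  "(real \<Rightarrow> 'a) \<Rightarrow> (real \<Rightarrow> 'a) \<Rightarrow> (real \<Rightarrow> 'a) \<Rightarrow> real^2 \<Rightarrow> real^2 \<Rightarrow> real^2 \<Rightarrow> ('a \<times> (real^2)) set"
  where
  "comparison_points \<alpha> \<beta> \<gamma> p' q' r' =
     (\<lambda>t. (\<alpha> t, (1 - t) *\<^sub>R p' + t *\<^sub>R q')) ` {0..1} \<union>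
     (\<lambda>t. (\<beta> t, (1 - t) *\<^sub>R q' + t *\<^sub>R r')) ` {0..1} \<union>
     (\<lambda>t. (\<gamma> t, (1 - t) *\<^sub>R r' + t *\<^sub>R p')) ` {0..1}"

class cat0_space = metric_space +
  assumes geodesic_exists: "\<exists>\<gamma>. geodesic \<gamma> x y"
    and cat0_inequality:
      "\<lbrakk>geodesic \<alpha> p q; geodesic \<beta> q r; geodesic \<gamma> r p; comparison_triangle p q r p' q' r';
        (u, u') \<in> comparison_points \<alpha> \<beta> \<gamma> p' q' r'; (v, v') \<in> comparison_points \<alpha> \<beta> \<gamma> p' q' r'\<rbrakk>
       \<Longrightarrow> dist u v \<le> dist u' v'"

class hadamard_space = cat0_space + complete_space

text \<open>
  The point \<open>(1 - t) x \<oplus> t y\<close>, for \<open>t\<close> in \<open>[0, 1]\<close>. Geodesics are determined only on \<open>[0, 1]\<close>, hence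
  the description of the point rather than of the geodesic.
\<close>

definition geodesic_point :: "'a::metric_space \<Rightarrow> 'a \<Rightarrow> real \<Rightarrow> 'a" where
  "geodesic_point x y t = (THE z. \<exists>\<gamma>. geodesic \<gamma> x y \<and> \<gamma> t = z)"

text \<open>
  Functions into \<open>(-\<infinity>, +\<infinity>]\<close> are \<open>ereal\<close>-valued functions that avoid \<open>-\<infinity>\<close>; this is part of
  \<open>proper_fun\<close>.
\<close>

definition proper_fun :: "('a \<Rightarrow> ereal) \<Rightarrow> bool" where
  "proper_fun g \<longleftrightarrow> (\<forall>x. g x \<noteq> -\<infinity>) \<and> {x. g x < \<infinity>} \<noteq> {}"

definition lower_semicontinuous :: "('a::metric_space \<Rightarrow> ereal) \<Rightarrow> bool" where
  "lower_semicontinuous g \<longleftrightarrow>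
     (\<forall>u x. u \<longlonglongrightarrow> x \<longrightarrow> g x \<le> liminf (\<lambda>n. g (u n)))"

definition geodesically_convex :: "('a::metric_space \<Rightarrow> ereal) \<Rightarrow> bool" where
  "geodesically_convex g \<longleftrightarrow>
     (\<forall>x y. \<forall>t\<in>{0<..<1}. g (geodesic_point x y t) \<le> ereal (1 - t) * g x + ereal t * g y)"

definition argmin_set :: "('a \<Rightarrow> ereal) \<Rightarrow> 'a set" where
  "argmin_set g = {x. is_arg_min g (\<lambda>_. True) x}"

definition resolvent :: "real \<Rightarrow> ('a::metric_space \<Rightarrow> ereal) \<Rightarrow> 'a \<Rightarrow> 'a" where
  "resolvent lam g x =
     (THE z. z \<in> argmin_set (\<lambda>y. g y + ereal (1 / (2 * lam) * (dist x y)\<^sup>2)))"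

text \<open>The limits superior are taken in \<open>ereal\<close>; for bounded sequences they are finite.\<close>

definition asymptotic_center :: "(nat \<Rightarrow> 'a::metric_space) \<Rightarrow> 'a set" where
  "asymptotic_center x =
     {z. limsup (\<lambda>n. ereal (dist z (x n))) = (INF y. limsup (\<lambda>n. ereal (dist y (x n))))}"

definition Delta_convergent :: "(nat \<Rightarrow> 'a::metric_space) \<Rightarrow> 'a \<Rightarrow> bool" where
  "Delta_convergent x z \<longleftrightarrow> bounded (range x) \<and>
     (\<forall>r::nat \<Rightarrow> nat. strict_mono r \<longrightarrow> asymptotic_center (x \<circ> r) = {z})"

text \<open>
  \<open>resolvent_product m lam f\<close> is the composition \<open>R m \<circ> \<dots> \<circ> R 1\<close> with \<open>R i = resolvent (lam i) (f i)\<close>: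
  \<open>fold\<close> applies the functions in list order, so \<open>R 1\<close> acts first.
\<close>

definition resolvent_product ::
  "nat \<Rightarrow> (nat \<Rightarrow> real) \<Rightarrow> (nat \<Rightarrow> 'a::metric_space \<Rightarrow> ereal) \<Rightarrow> 'a \<Rightarrow> 'a" where
  "resolvent_product m lam f = fold (\<lambda>i. resolvent (lam i) (f i)) [1..<Suc m]"

end

theory Submission
  imports Defs
begin

text \<open>
  The engine is the CN inequality: on a \<open>CAT(0)\<close> space every function \<open>d(z, \<cdot>)\<^sup>2\<close> is uniformly
  convex along geodesics. In a complete space this gives unique minimizers in two situations
  (\<open>unique_minimizer\<close>): for \<open>g + d(x, \<cdot>)\<^sup>2 / (2\<lambda>)\<close>, so that resolvents exist, and for the squared
  asymptotic radius of a bounded sequence, so that asymptotic centers are singletons.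

  Comparing the resolvent \<open>z\<close> of \<open>x\<close> with nearby points of the geodesic from \<open>z\<close> to \<open>y\<close> yields
  \<open>g(z) \<le> g(y) + (d(x, y)\<^sup>2 - d(x, z)\<^sup>2 - d(z, y)\<^sup>2) / (2\<lambda>)\<close> (\<open>resolvent_inequality\<close>), and everything else is read off from this. If \<open>y = p\<close> minimizes all
  \<open>f\<^sub>i\<close>, each resolvent in the product decreases the distance to \<open>p\<close>, so along the orbit \<open>x\<^sub>n\<close>
  the distances to \<open>p\<close> of all intermediate points have the same limit. The telescoping differences
  of their squares therefore vanish, and these bound both the squared displacement at each stage and
  the excess of \<open>f\<^sub>i\<close> at the output of stage \<open>i\<close> over \<open>min f\<^sub>i\<close>. Thus the outputs of stage \<open>i\<close> form a
  minimizing sequence for \<open>f\<^sub>i\<close> that is asymptotic to \<open>x\<^sub>n\<close>.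

  The asymptotic center of a minimizing sequence is a minimizer
  (\<open>asymptotic_center_minimizing_sequence\<close>), hence the asymptotic centers of all subsequences of
  \<open>x\<^sub>n\<close> are common minimizers of the \<open>f\<^sub>i\<close>. Since the distances from \<open>x\<^sub>n\<close> to any common minimizer
  converge, these centers all coincide (\<open>Fejer_Delta_convergent\<close>). Finally, a common minimizer of
  the \<open>f\<^sub>i\<close> minimizes their sum.
\<close>

section \<open>The CN inequality\<close>

text \<open>
  Put \<open>p\<close> at the origin and \<open>q\<close> on the first axis; the law of cosines dictates the first coordinate
  \<open>s\<close> of \<open>r\<close>, and the triangle inequality says exactly that the height \<open>h\<close> can be chosen real.
\<close>

lemma comparison_triangle_exists:
  fixes p q r :: "'a::metric_space"
  shows "\<exists>p' q' r'. comparison_triangle p q r p' q' r'"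
proof -
  define a b c where "a = dist p q" and "b = dist q r" and "c = dist r p"
  have tri: "a \<le> b + c" "b \<le> a + c" "c \<le> a + b" and nn: "a \<ge> 0" "b \<ge> 0" "c \<ge> 0"
    unfolding a_def b_def c_def by metric+
  have dist2: "dist (vector [u, v] :: real^2) (vector [u', v']) = sqrt ((u - u')\<^sup>2 + (v - v')\<^sup>2)"
    for u v u' v'
    by (simp add: dist_vec_def L2_set_def UNIV_2 dist_real_def)
  obtain s h where sh: "s\<^sup>2 + h\<^sup>2 = c\<^sup>2" "(a - s)\<^sup>2 + h\<^sup>2 = b\<^sup>2"
  proof (cases "a = 0")
    case True
    then have "b = c" using tri by simp
    with True that[of c 0] show ?thesis by simp
  next
    case False
    then have "a > 0" using nn by simp
    define s where "s = (a\<^sup>2 + c\<^sup>2 - b\<^sup>2) / (2 * a)"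
    have s: "2 * a * s = a\<^sup>2 + c\<^sup>2 - b\<^sup>2" using \<open>a > 0\<close> by (simp add: s_def)
    have "b\<^sup>2 \<le> (a + c)\<^sup>2" using tri nn by (intro power_mono) auto
    then have "2 * a * s \<ge> 2 * a * (- c)" using s by (simp add: power2_sum)
    then have 1: "s \<ge> - c" using \<open>a > 0\<close> by (subst (asm) mult_le_cancel_left_pos) auto
    have "\<bar>a - c\<bar> \<le> \<bar>b\<bar>" using tri nn by simp
    then have "(a - c)\<^sup>2 \<le> b\<^sup>2" by (simp only: abs_le_square_iff)
    then have "2 * a * s \<le> 2 * a * c" using s by (simp add: power2_diff)
    then have "s \<le> c" using \<open>a > 0\<close> by simp
    with 1 have "\<bar>s\<bar> \<le> \<bar>c\<bar>" by simp
    then have "s\<^sup>2 \<le> c\<^sup>2" by (simp only: abs_le_square_iff)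
    then have h: "(sqrt (c\<^sup>2 - s\<^sup>2))\<^sup>2 = c\<^sup>2 - s\<^sup>2" by simp
    show ?thesis
      using s by (intro that[of s "sqrt (c\<^sup>2 - s\<^sup>2)"]) (simp_all add: h power2_diff)
  qed
  have "comparison_triangle p q r (vector [0, 0]) (vector [a, 0]) (vector [s, h])"
    unfolding comparison_triangle_def dist2
    using sh nn by (simp add: a_def[symmetric] b_def[symmetric] c_def[symmetric])
  then show ?thesis by blast
qed

lemma dist_affine_combination_square:
  fixes w p q :: "'a::real_inner"
  shows "(dist w ((1 - t) *\<^sub>R p + t *\<^sub>R q))\<^sup>2
    = (1 - t) * (dist w p)\<^sup>2 + t * (dist w q)\<^sup>2 - t * (1 - t) * (dist p q)\<^sup>2"
  by (simp add: dist_norm power2_norm_eq_inner inner_diff_left inner_diff_right inner_add_left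
      inner_add_right inner_commute algebra_simps)

text \<open>
  The comparison inequality between the vertex \<open>z\<close> and a point of the opposite side, with the
  Euclidean distance evaluated by Stewart's theorem (\<open>dist_affine_combination_square\<close>).
\<close>

lemma geodesic_CN:
  fixes x y z :: "'a::cat0_space"
  assumes "geodesic \<alpha> x y" and "0 \<le> t" "t \<le> 1"
  shows "(dist z (\<alpha> t))\<^sup>2 \<le> (1 - t) * (dist z x)\<^sup>2 + t * (dist z y)\<^sup>2 - t * (1 - t) * (dist x y)\<^sup>2"
proof -
  obtain \<beta> \<gamma> where bg: "geodesic \<beta> y z" "geodesic \<gamma> z x"
    using geodesic_exists by blast
  obtain x' y' z' where tri: "comparison_triangle x y z x' y' z'"
    using comparison_triangle_exists by blast
  have 1: "(\<alpha> t, (1 - t) *\<^sub>R x' + t *\<^sub>R y') \<in> comparison_points \<alpha> \<beta> \<gamma> x' y' z'"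
    using assms unfolding comparison_points_def by auto
  have "(\<beta> 1, (1 - 1) *\<^sub>R y' + 1 *\<^sub>R z') \<in> comparison_points \<alpha> \<beta> \<gamma> x' y' z'"
    unfolding comparison_points_def by (intro UnI1 UnI2 image_eqI[where x = 1]) auto
  then have 2: "(z, z') \<in> comparison_points \<alpha> \<beta> \<gamma> x' y' z'"
    using bg(1) by (simp add: geodesic_def)
  have "dist z (\<alpha> t) \<le> dist z' ((1 - t) *\<^sub>R x' + t *\<^sub>R y')"
    by (rule cat0_inequality[OF assms(1) bg tri 2 1])
  then have "(dist z (\<alpha> t))\<^sup>2 \<le> (dist z' ((1 - t) *\<^sub>R x' + t *\<^sub>R y'))\<^sup>2"
    by (intro power_mono) auto
  then show ?thesis
    using tri by (simp add: dist_affine_combination_square comparison_triangle_def dist_commute)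
qed

text \<open>
  For \<open>z = \<beta> t\<close> the right-hand side of the CN inequality vanishes identically.
\<close>

lemma geodesic_unique:
  fixes x y :: "'a::cat0_space"
  assumes "geodesic \<alpha> x y" "geodesic \<beta> x y" and "0 \<le> t" "t \<le> 1"
  shows "\<alpha> t = \<beta> t"
proof -
  have "dist (\<beta> t) (\<beta> 0) = dist x y * \<bar>t - 0\<bar>" "dist (\<beta> t) (\<beta> 1) = dist x y * \<bar>t - 1\<bar>"
    using assms unfolding geodesic_def by (metis atLeastAtMost_iff order_refl zero_le_one)+
  then have "dist (\<beta> t) x = dist x y * t" "dist (\<beta> t) y = dist x y * (1 - t)"
    using assms by (auto simp: geodesic_def)
  then have "(dist (\<beta> t) (\<alpha> t))\<^sup>2
      \<le> (1 - t) * (dist x y * t)\<^sup>2 + t * (dist x y * (1 - t))\<^sup>2 - t * (1 - t) * (dist x y)\<^sup>2"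
    using geodesic_CN[OF assms(1,3,4), of "\<beta> t"] by simp
  also have "\<dots> = 0" by (simp add: power2_eq_square algebra_simps)
  finally show ?thesis by simp
qed

lemma geodesic_point_CN:
  fixes x y z :: "'a::cat0_space"
  assumes "0 \<le> t" "t \<le> 1"
  shows "(dist z (geodesic_point x y t))\<^sup>2
    \<le> (1 - t) * (dist z x)\<^sup>2 + t * (dist z y)\<^sup>2 - t * (1 - t) * (dist x y)\<^sup>2"
proof -
  obtain \<alpha> where \<alpha>: "geodesic \<alpha> x y" using geodesic_exists by blast
  have "geodesic_point x y t = \<alpha> t"
    unfolding geodesic_point_def using \<alpha> geodesic_unique[OF _ \<alpha> assms] by (intro the_equality) blast+
  then show ?thesis using geodesic_CN[OF \<alpha> assms] by simp
qed

lemma midpoint_CN: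
  fixes x y z :: "'a::cat0_space"
  shows "(dist z (geodesic_point x y (1/2)))\<^sup>2
    \<le> ((dist z x)\<^sup>2 + (dist z y)\<^sup>2) / 2 - (dist x y)\<^sup>2 / 4"
  using geodesic_point_CN[of "1/2" z x y] by (simp add: field_simps)

section \<open>Minimizers of uniformly convex functions\<close>

text \<open>
  Two points at which \<open>h\<close> is within \<open>e\<close> of its infimum satisfy \<open>c d(a, b)\<^sup>2 \<le> e\<close>, since otherwise the
  approximate midpoint would fall below the infimum. So minimizing sequences are Cauchy. Convexity
  is stated through real upper bounds \<open>A\<close>, \<open>B\<close>, which makes it void where \<open>h\<close> is infinite and avoids
  extended real arithmetic.
\<close>

lemma unique_minimizer:
  fixes h :: "'a::complete_space \<Rightarrow> ereal"
  assumes below: "\<And>y. ereal L \<le> h y" and proper: "h y0 < \<infinity>"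
    and lsc: "lower_semicontinuous h" and "c > 0"
    and conv: "\<And>a b A B. \<lbrakk>h a \<le> ereal A; h b \<le> ereal B\<rbrakk>
      \<Longrightarrow> \<exists>m. h m \<le> ereal ((A + B) / 2 - c * (dist a b)\<^sup>2)"
  shows "\<exists>!z. \<forall>y. h z \<le> h y"
proof -
  have "(INF y. h y) \<ge> ereal L" using below by (intro INF_greatest)
  moreover have "(INF y. h y) < \<infinity>" using proper by (meson INF_lower UNIV_I order_le_less_trans)
  ultimately obtain I where I: "(INF y. h y) = ereal I" by (cases "INF y. h y") auto
  have lower: "ereal I \<le> h y" for y using I by (metis INF_lower UNIV_I)
  have close: "c * (dist a b)\<^sup>2 \<le> e" if ab: "h a \<le> ereal (I + e)" "h b \<le> ereal (I + e)" for a b e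
  proof -
    obtain m where m: "h m \<le> ereal ((I + e + (I + e)) / 2 - c * (dist a b)\<^sup>2)"
      using conv[OF ab] by blast
    from order_trans[OF lower m] show ?thesis by (simp add: field_simps)
  qed
  have "\<exists>u. h u \<le> ereal (I + 1 / real (Suc n))" for n
  proof -
    have "(INF y. h y) < ereal (I + 1 / real (Suc n))" using I by simp
    then show ?thesis unfolding INF_less_iff by (auto intro: less_imp_le)
  qed
  then obtain u where u: "\<And>n. h (u n) \<le> ereal (I + 1 / real (Suc n))" by metis
  have "Cauchy u"
  proof (rule metric_CauchyI)
    fix e :: real assume "e > 0"
    then have "c * e\<^sup>2 > 0" using \<open>c > 0\<close> by simp
    then obtain N where N: "1 / real (Suc N) < c * e\<^sup>2" using nat_approx_posE by blast
    have tail: "h (u n) \<le> ereal (I + 1 / real (Suc N))" if "n \<ge> N" for n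
    proof -
      have "1 / real (Suc n) \<le> 1 / real (Suc N)" using that by (simp add: frac_le)
      then show ?thesis using u[of n] by (meson add_left_mono ereal_less_eq(3) order_trans)
    qed
    have "dist (u k) (u n) < e" if "k \<ge> N" "n \<ge> N" for k n
    proof -
      have "c * (dist (u k) (u n))\<^sup>2 < c * e\<^sup>2" using close[OF tail tail] that N by fastforce
      then show ?thesis using \<open>c > 0\<close> \<open>e > 0\<close> power2_less_imp_less by fastforce
    qed
    then show "\<exists>N. \<forall>k\<ge>N. \<forall>n\<ge>N. dist (u k) (u n) < e" by blast
  qed
  then obtain z where "u \<longlonglongrightarrow> z" using Cauchy_convergent convergent_def by blast
  then have "h z \<le> liminf (\<lambda>n. h (u n))" using lsc by (simp add: lower_semicontinuous_def)
  also have "\<dots> \<le> liminf (\<lambda>n. ereal (I + 1 / real (Suc n)))"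
    using u by (intro Liminf_mono) auto
  also have "\<dots> = ereal I"
  proof (intro lim_imp_Liminf)
    have "(\<lambda>n. I + 1 / real (Suc n)) \<longlonglongrightarrow> I + 0"
      by (intro tendsto_intros LIMSEQ_Suc lim_1_over_n)
    then show "(\<lambda>n. ereal (I + 1 / real (Suc n))) \<longlonglongrightarrow> ereal I" by simp
  qed simp
  finally have "h z \<le> ereal I" .
  then have min: "\<forall>y. h z \<le> h y" using lower order_trans by blast
  moreover have "w = z" if w: "\<forall>y. h w \<le> h y" for w
  proof -
    have "h w \<le> ereal I" using w \<open>h z \<le> ereal I\<close> order_trans by blast
    then have "c * (dist w z)\<^sup>2 \<le> 0" using close[of w 0 z] \<open>h z \<le> ereal I\<close> by simp
    then show ?thesis using \<open>c > 0\<close> by (simp add: mult_le_0_iff)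
  qed
  ultimately show ?thesis by blast
qed

lemma argmin_set_iff: "z \<in> argmin_set g \<longleftrightarrow> (\<forall>y. g z \<le> g y)"
  for g :: "'a \<Rightarrow> ereal"
  by (auto simp: argmin_set_def is_arg_min_def not_less)

lemma convex_le:
  assumes "geodesically_convex g" and "g x \<le> ereal A" "g y \<le> ereal B" and "0 < t" "t < 1"
  shows "g (geodesic_point x y t) \<le> ereal ((1 - t) * A + t * B)"
proof -
  have "g (geodesic_point x y t) \<le> ereal (1 - t) * g x + ereal t * g y"
    using assms by (simp add: geodesically_convex_def)
  also have "\<dots> \<le> ereal (1 - t) * ereal A + ereal t * ereal B"
    using assms by (intro add_mono ereal_mult_left_mono) auto
  finally show ?thesis by simp
qed

section \<open>Resolvents\<close>

text \<open>
  A lower bound on \<open>g\<close> is assumed, which holds whenever \<open>g\<close> attains its minimum; it lets the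
  existence of the minimizer follow directly from \<open>unique_minimizer\<close>, with modulus \<open>1 / (8\<lambda>)\<close> from the
  CN inequality at midpoints.
\<close>

lemma resolvent_minimizes:
  fixes g :: "'a::hadamard_space \<Rightarrow> ereal"
  assumes "lower_semicontinuous g" and conv: "geodesically_convex g"
    and below: "\<And>y. ereal L \<le> g y" and "g y0 < \<infinity>" and "lam > 0"
  shows "g (resolvent lam g x) + ereal (1 / (2 * lam) * (dist x (resolvent lam g x))\<^sup>2)
    \<le> g y + ereal (1 / (2 * lam) * (dist x y)\<^sup>2)"
proof -
  define h where "h y = g y + ereal (1 / (2 * lam) * (dist x y)\<^sup>2)" for y
  have "\<exists>!z. \<forall>y. h z \<le> h y"
  proof (rule unique_minimizer)
    show "ereal L \<le> h y" for y
    proof -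
      have "ereal L + 0 \<le> h y"
        unfolding h_def using below \<open>lam > 0\<close> by (intro add_mono) auto
      then show ?thesis by simp
    qed
    show "h y0 < \<infinity>" using assms(4) by (simp add: h_def)
    show "lower_semicontinuous h"
      unfolding lower_semicontinuous_def
    proof (intro allI impI)
      fix u and z :: 'a assume u: "u \<longlonglongrightarrow> z"
      let ?q = "\<lambda>y. ereal (1 / (2 * lam) * (dist x y)\<^sup>2)"
      have "(\<lambda>n. ?q (u n)) \<longlonglongrightarrow> ?q z" using u by (intro tendsto_intros)
      then have "liminf (\<lambda>n. ?q (u n) + g (u n)) = ?q z + liminf (\<lambda>n. g (u n))"
        by (intro ereal_liminf_lim_add) auto
      moreover have "g z \<le> liminf (\<lambda>n. g (u n))"
        using assms(1) u by (simp add: lower_semicontinuous_def)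
      ultimately show "h z \<le> liminf (\<lambda>n. h (u n))"
        by (simp only: h_def add.commute[of "g _"] add_left_mono)
    qed
    show "0 < 1 / (8 * lam)" using \<open>lam > 0\<close> by simp
    show "\<exists>m. h m \<le> ereal ((A + B) / 2 - 1 / (8 * lam) * (dist a b)\<^sup>2)"
      if ab: "h a \<le> ereal A" "h b \<le> ereal B" for a b A B
    proof -
      let ?q = "\<lambda>y. 1 / (2 * lam) * (dist x y)\<^sup>2" and ?m = "geodesic_point a b (1/2)"
      have "g a \<le> ereal (A - ?q a)" "g b \<le> ereal (B - ?q b)"
        using ab unfolding h_def by (cases "g a"; cases "g b"; auto simp: le_diff_eq)+
      then have "g ?m \<le> ereal ((1 - 1/2) * (A - ?q a) + 1/2 * (B - ?q b))"
        by (intro convex_le[OF conv]) auto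
      then have "h ?m \<le> ereal ((1 - 1/2) * (A - ?q a) + 1/2 * (B - ?q b) + ?q ?m)"
        unfolding h_def plus_ereal.simps(1)[symmetric] by (rule add_right_mono)
      moreover have "?q ?m \<le> 1 / (2 * lam) * (((dist x a)\<^sup>2 + (dist x b)\<^sup>2) / 2 - (dist a b)\<^sup>2 / 4)"
        using midpoint_CN \<open>lam > 0\<close> by (intro mult_left_mono) auto
      then have "(1 - 1/2) * (A - ?q a) + 1/2 * (B - ?q b) + ?q ?m
          \<le> (A + B) / 2 - 1 / (8 * lam) * (dist a b)\<^sup>2"
        by (simp add: algebra_simps add_divide_distrib)
      ultimately have "h ?m \<le> ereal ((A + B) / 2 - 1 / (8 * lam) * (dist a b)\<^sup>2)"
        by (meson ereal_less_eq(3) order_trans)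
      then show ?thesis by blast
    qed
  qed
  then have "\<forall>y. h (THE z. \<forall>y. h z \<le> h y) \<le> h y" by (rule theI')
  then show ?thesis
    by (simp add: resolvent_def argmin_set_iff h_def)
qed

text \<open>
  Minimality of \<open>z\<close> against the point \<open>w\<close> at parameter \<open>t\<close> on the geodesic from \<open>z\<close> to \<open>y\<close>, together
  with convexity of \<open>g\<close> and the CN inequality, gives an inequality whose terms all carry a factor
  \<open>t\<close>. Dividing by \<open>t\<close> and letting \<open>t \<rightarrow> 0\<close> retains the full term \<open>d(z, y)\<^sup>2\<close>.
\<close>

lemma resolvent_inequality:
  fixes g :: "'a::hadamard_space \<Rightarrow> ereal"
  assumes lsc: "lower_semicontinuous g" and conv: "geodesically_convex g"
    and below: "\<And>y. ereal L \<le> g y" and "lam > 0"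
    and Y: "g y \<le> ereal Y" and z: "z = resolvent lam g x"
  shows "g z \<le> ereal (Y + 1 / (2 * lam) * ((dist x y)\<^sup>2 - (dist x z)\<^sup>2 - (dist z y)\<^sup>2))"
proof -
  define k where "k = 1 / (2 * lam)"
  have "k > 0" using \<open>lam > 0\<close> by (simp add: k_def)
  have "g y < \<infinity>" using Y by auto
  note min = resolvent_minimizes[OF lsc conv below this \<open>lam > 0\<close>, of x,
      folded z k_def]
  have "g z \<noteq> \<infinity>" using min[of y] Y by auto
  then obtain Z where Z: "g z = ereal Z" using below[of z] by (cases "g z") auto
  have ineq: "Z + k * (dist x z)\<^sup>2 \<le> Y + k * (dist x y)\<^sup>2 - (1 - t) * (k * (dist z y)\<^sup>2)"
    if t: "0 < t" "t < 1" for t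
  proof -
    let ?w = "geodesic_point z y t"
    have "g ?w \<le> ereal ((1 - t) * Z + t * Y)" using Z Y t by (intro convex_le[OF conv]) auto
    then have "g ?w + ereal (k * (dist x ?w)\<^sup>2) \<le> ereal ((1 - t) * Z + t * Y + k * (dist x ?w)\<^sup>2)"
      unfolding plus_ereal.simps(1)[symmetric] by (rule add_right_mono)
    from order_trans[OF min[of ?w] this]
    have "Z + k * (dist x z)\<^sup>2 \<le> (1 - t) * Z + t * Y + k * (dist x ?w)\<^sup>2"
      by (simp add: Z)
    also have "k * (dist x ?w)\<^sup>2
        \<le> k * ((1 - t) * (dist x z)\<^sup>2 + t * (dist x y)\<^sup>2 - t * (1 - t) * (dist z y)\<^sup>2)"
      using geodesic_point_CN[of t x z y] t \<open>k > 0\<close> by (intro mult_left_mono) auto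
    finally have "t * (Z + k * (dist x z)\<^sup>2)
        \<le> t * (Y + k * (dist x y)\<^sup>2 - (1 - t) * (k * (dist z y)\<^sup>2))"
      by (simp add: algebra_simps)
    then show ?thesis using t by simp
  qed
  have "((\<lambda>t. Y + k * (dist x y)\<^sup>2 - (1 - t) * (k * (dist z y)\<^sup>2))
      \<longlongrightarrow> Y + k * (dist x y)\<^sup>2 - (1 - 0) * (k * (dist z y)\<^sup>2)) (at_right 0)"
    by (intro tendsto_intros)
  moreover have "\<forall>\<^sub>F t in at_right 0.
      Z + k * (dist x z)\<^sup>2 \<le> Y + k * (dist x y)\<^sup>2 - (1 - t) * (k * (dist z y)\<^sup>2)"
    using ineq by (auto simp: eventually_at_right_field intro!: exI[of _ 1])
  ultimately have "Z + k * (dist x z)\<^sup>2 \<le> Y + k * (dist x y)\<^sup>2 - (1 - 0) * (k * (dist z y)\<^sup>2)"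
    by (intro tendsto_lowerbound) auto
  then show ?thesis unfolding Z k_def[symmetric] by (simp add: algebra_simps)
qed

section \<open>Asymptotic centers\<close>

text \<open>
  The real value is meaningful for bounded sequences only, where it is the limit superior itself
  (\<open>ereal_asymptotic_radius\<close>).
\<close>

definition asymptotic_radius :: "(nat \<Rightarrow> 'a::metric_space) \<Rightarrow> 'a \<Rightarrow> real" where
  "asymptotic_radius x y = real_of_ereal (limsup (\<lambda>n. ereal (dist y (x n))))"

lemma ereal_asymptotic_radius:
  assumes "bounded (range x)"
  shows "ereal (asymptotic_radius x y) = limsup (\<lambda>n. ereal (dist y (x n)))"
proof -
  obtain B where B: "\<And>n. dist y (x n) \<le> B"
    using assms by (metis bounded_any_center rangeI)
  then have "limsup (\<lambda>n. ereal (dist y (x n))) \<le> ereal B"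
    by (intro Limsup_bounded) auto
  moreover have "0 \<le> limsup (\<lambda>n. ereal (dist y (x n)))"
    by (intro le_Limsup) auto
  ultimately show ?thesis
    by (cases "limsup (\<lambda>n. ereal (dist y (x n)))") (auto simp: asymptotic_radius_def)
qed

lemma asymptotic_radius_nonneg:
  assumes "bounded (range x)"
  shows "0 \<le> asymptotic_radius x y"
proof -
  have "0 \<le> limsup (\<lambda>n. ereal (dist y (x n)))"
    by (intro le_Limsup) auto
  then show ?thesis unfolding ereal_asymptotic_radius[OF assms, symmetric] by simp
qed

lemma asymptotic_radius_le:
  assumes "bounded (range x)" "\<forall>\<^sub>F n in sequentially. dist y (x n) \<le> c"
  shows "asymptotic_radius x y \<le> c"
proof -
  have "limsup (\<lambda>n. ereal (dist y (x n))) \<le> ereal c"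
    using assms(2) by (intro Limsup_bounded) (auto elim: eventually_mono)
  then show ?thesis unfolding ereal_asymptotic_radius[OF assms(1), symmetric] by simp
qed

lemma eventually_dist_less:
  assumes "bounded (range x)" "asymptotic_radius x y < c"
  shows "\<forall>\<^sub>F n in sequentially. dist y (x n) < c"
proof -
  have "limsup (\<lambda>n. ereal (dist y (x n))) < ereal c"
    using assms(2) unfolding ereal_asymptotic_radius[OF assms(1), symmetric] by simp
  then show ?thesis by (auto dest: Limsup_lessD)
qed

text \<open>
  Squared radii are what the CN inequality controls. The next two lemmas let inequalities between
  squared distances pass to squared radii without manipulating limits superior of sums.
\<close>

lemma asymptotic_radius_square_le:
  assumes "bounded (range x)"
    and "\<And>e. e > 0 \<Longrightarrow> \<forall>\<^sub>F n in sequentially. (dist y (x n))\<^sup>2 \<le> c + e"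
  shows "(asymptotic_radius x y)\<^sup>2 \<le> c"
proof (rule field_le_epsilon)
  fix e :: real assume "e > 0"
  note ev = assms(2)[OF this]
  then obtain n where "(dist y (x n))\<^sup>2 \<le> c + e" using eventually_happens'[OF _ ev] by auto
  then have nn: "0 \<le> c + e" by (meson order_trans zero_le_power2)
  have "asymptotic_radius x y \<le> sqrt (c + e)"
    using ev by (intro asymptotic_radius_le[OF assms(1)]) (auto elim!: eventually_mono intro: real_le_rsqrt)
  then have "(asymptotic_radius x y)\<^sup>2 \<le> (sqrt (c + e))\<^sup>2"
    using asymptotic_radius_nonneg[OF assms(1)] by (intro power_mono)
  then show "(asymptotic_radius x y)\<^sup>2 \<le> c + e" using nn by simp
qed

lemma eventually_dist_square_less:
  assumes "bounded (range x)" "e > 0"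
  shows "\<forall>\<^sub>F n in sequentially. (dist y (x n))\<^sup>2 < (asymptotic_radius x y)\<^sup>2 + e"
proof -
  let ?R = "asymptotic_radius x y"
  have "?R = sqrt (?R\<^sup>2)" using asymptotic_radius_nonneg[OF assms(1)] by simp
  also have "\<dots> < sqrt (?R\<^sup>2 + e)" using assms(2) by (intro real_sqrt_less_mono) simp
  finally show ?thesis
  proof (rule eventually_mono[OF eventually_dist_less[OF assms(1)]])
    fix n assume "dist y (x n) < sqrt (?R\<^sup>2 + e)"
    then have "(dist y (x n))\<^sup>2 < (sqrt (?R\<^sup>2 + e))\<^sup>2" by (intro power_strict_mono) auto
    then show "(dist y (x n))\<^sup>2 < ?R\<^sup>2 + e" using assms(2) by simp
  qed
qed

lemma asymptotic_center_iff:
  assumes "bounded (range x)"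
  shows "z \<in> asymptotic_center x \<longleftrightarrow> (\<forall>y. asymptotic_radius x z \<le> asymptotic_radius x y)"
proof -
  have "z \<in> asymptotic_center x
      \<longleftrightarrow> ereal (asymptotic_radius x z) = (INF y. ereal (asymptotic_radius x y))"
    by (simp add: asymptotic_center_def ereal_asymptotic_radius[OF assms])
  also have "\<dots> \<longleftrightarrow> (\<forall>y. ereal (asymptotic_radius x z) \<le> ereal (asymptotic_radius x y))"
    by (metis (mono_tags, lifting) INF_greatest INF_lower UNIV_I antisym)
  finally show ?thesis by simp
qed

text \<open>
  The squared radius inherits uniform convexity from the squared distances \<open>d(\<cdot>, x\<^sub>n)\<^sup>2\<close>, and it is
  continuous because the radius is 1-Lipschitz; its minimizers are the asymptotic centers.
\<close>

lemma asymptotic_center_singleton: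
  fixes x :: "nat \<Rightarrow> 'a::hadamard_space"
  assumes bdd: "bounded (range x)"
  shows "\<exists>z. asymptotic_center x = {z}"
proof -
  let ?R = "asymptotic_radius x"
  have lip: "?R y \<le> ?R z + dist y z" for y z
  proof (rule field_le_epsilon)
    fix e :: real assume "e > 0"
    then have "\<forall>\<^sub>F n in sequentially. dist z (x n) < ?R z + e"
      by (intro eventually_dist_less[OF bdd]) simp
    then have "\<forall>\<^sub>F n in sequentially. dist y (x n) \<le> ?R z + dist y z + e"
    proof (rule eventually_mono)
      fix n assume "dist z (x n) < ?R z + e"
      then show "dist y (x n) \<le> ?R z + dist y z + e"
        using dist_triangle[of y "x n" z] by linarith
    qed
    then show "?R y \<le> ?R z + dist y z + e" by (rule asymptotic_radius_le[OF bdd])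
  qed
  have "\<exists>!z. \<forall>y. ereal ((?R z)\<^sup>2) \<le> ereal ((?R y)\<^sup>2)"
  proof (rule unique_minimizer)
    show "ereal 0 \<le> ereal ((?R y)\<^sup>2)" for y by simp
    show "ereal ((?R undefined)\<^sup>2) < \<infinity>" by simp
    show "lower_semicontinuous (\<lambda>y. ereal ((?R y)\<^sup>2))"
      unfolding lower_semicontinuous_def
    proof (intro allI impI)
      fix u and z :: 'a assume u: "u \<longlonglongrightarrow> z"
      have "(\<lambda>n. ?R (u n)) \<longlonglongrightarrow> ?R z"
      proof (rule tendstoI)
        fix e :: real assume "e > 0"
        with u have "\<forall>\<^sub>F n in sequentially. dist (u n) z < e" by (rule tendstoD)
        then show "\<forall>\<^sub>F n in sequentially. dist (?R (u n)) (?R z) < e"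
        proof (rule eventually_mono)
          fix n assume "dist (u n) z < e"
          then show "dist (?R (u n)) (?R z) < e"
            using lip[of "u n" z] lip[of z "u n"] by (simp add: dist_real_def dist_commute)
        qed
      qed
      then have "(\<lambda>n. ereal ((?R (u n))\<^sup>2)) \<longlonglongrightarrow> ereal ((?R z)\<^sup>2)"
        by (intro tendsto_intros)
      from lim_imp_Liminf[OF _ this]
      show "ereal ((?R z)\<^sup>2) \<le> liminf (\<lambda>n. ereal ((?R (u n))\<^sup>2))" by simp
    qed
    show "(0::real) < 1 / 4" by simp
    show "\<exists>m. ereal ((?R m)\<^sup>2) \<le> ereal ((A + B) / 2 - 1 / 4 * (dist a b)\<^sup>2)"
      if AB: "ereal ((?R a)\<^sup>2) \<le> ereal A" "ereal ((?R b)\<^sup>2) \<le> ereal B" for a b A B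
    proof -
      let ?m = "geodesic_point a b (1/2)"
      have "(?R ?m)\<^sup>2 \<le> (A + B) / 2 - 1 / 4 * (dist a b)\<^sup>2"
      proof (rule asymptotic_radius_square_le[OF bdd])
        fix e :: real assume "e > 0"
        from eventually_dist_square_less[OF bdd this, of a]
          eventually_dist_square_less[OF bdd this, of b]
        show "\<forall>\<^sub>F n in sequentially.
            (dist ?m (x n))\<^sup>2 \<le> (A + B) / 2 - 1 / 4 * (dist a b)\<^sup>2 + e"
        proof eventually_elim
          case (elim n)
          then show ?case
            using midpoint_CN[of "x n" a b] AB by (simp add: dist_commute field_simps)
        qed
      qed
      then show ?thesis by auto
    qed
  qed
  moreover have "(\<forall>y. ereal ((?R z)\<^sup>2) \<le> ereal ((?R y)\<^sup>2)) \<longleftrightarrow> z \<in> asymptotic_center x" for z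
    using asymptotic_radius_nonneg[OF bdd]
    by (simp add: asymptotic_center_iff[OF bdd] power_mono_iff)
  ultimately have "\<exists>!z. z \<in> asymptotic_center x" by simp
  then show ?thesis by (metis is_singletonI' is_singletonE empty_iff)
qed

lemma asymptotic_center_cong:
  assumes "(\<lambda>n. dist (x n) (z n)) \<longlonglongrightarrow> 0"
  shows "asymptotic_center x = asymptotic_center z"
proof -
  have "limsup (\<lambda>n. ereal (dist y (x n))) = limsup (\<lambda>n. ereal (dist y (z n)))" for y
  proof -
    have "(\<lambda>n. dist y (x n) - dist y (z n)) \<longlonglongrightarrow> 0"
    proof (rule Lim_null_comparison[OF always_eventually assms], rule allI)
      show "norm (dist y (x n) - dist y (z n)) \<le> dist (x n) (z n)" for n
        using abs_dist_diff_le[of "x n" y "z n"] by (simp add: dist_commute)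
    qed
    then have "(\<lambda>n. ereal (dist y (x n) - dist y (z n))) \<longlonglongrightarrow> ereal 0" by (intro tendsto_ereal)
    from ereal_limsup_lim_add[OF this, of "\<lambda>n. ereal (dist y (z n))"]
    show ?thesis by simp
  qed
  then show ?thesis by (simp add: asymptotic_center_def)
qed

text \<open>
  Let \<open>b\<close> be a resolvent of the center \<open>a\<close>. The resolvent inequality with test point \<open>z\<^sub>n\<close>, where
  \<open>g(z\<^sub>n)\<close> tends to a lower bound of \<open>g\<close>, makes the squared radius at \<open>b\<close> smaller than that at \<open>a\<close> by
  at least \<open>d(a, b)\<^sup>2\<close>; as \<open>a\<close> is a center, \<open>b = a\<close>. Then the same inequality reads
  \<open>g(a) \<le> g(z\<^sub>n)\<close>.
\<close>

lemma asymptotic_center_minimizing_sequence: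
  fixes g :: "'a::hadamard_space \<Rightarrow> ereal"
  assumes lsc: "lower_semicontinuous g" and conv: "geodesically_convex g"
    and below: "\<And>y. ereal L \<le> g y"
    and G: "\<And>n. g (z n) \<le> ereal (G n)" "G \<longlonglongrightarrow> L"
    and bdd: "bounded (range z)" and a: "a \<in> asymptotic_center z"
  shows "g a \<le> ereal L"
proof -
  \<comment> \<open>Any positive parameter serves here.\<close>
  define b where "b = resolvent 1 g a"
  have R: "g b \<le> ereal (G n + 1/2 * ((dist a (z n))\<^sup>2 - (dist a b)\<^sup>2 - (dist b (z n))\<^sup>2))" for n
    using resolvent_inequality[OF lsc conv below _ G(1) b_def] by simp
  have "(asymptotic_radius z b)\<^sup>2 \<le> (asymptotic_radius z a)\<^sup>2 - (dist a b)\<^sup>2"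
  proof (rule asymptotic_radius_square_le[OF bdd])
    fix e :: real assume "e > 0"
    then have "\<forall>\<^sub>F n in sequentially. G n < L + e / 4" using G(2) by (intro order_tendstoD) auto
    moreover have "\<forall>\<^sub>F n in sequentially. (dist a (z n))\<^sup>2 < (asymptotic_radius z a)\<^sup>2 + e / 2"
      using \<open>e > 0\<close> by (intro eventually_dist_square_less[OF bdd]) simp
    ultimately show "\<forall>\<^sub>F n in sequentially.
        (dist b (z n))\<^sup>2 \<le> (asymptotic_radius z a)\<^sup>2 - (dist a b)\<^sup>2 + e"
    proof eventually_elim
      case (elim n)
      have "L \<le> G n + 1/2 * ((dist a (z n))\<^sup>2 - (dist a b)\<^sup>2 - (dist b (z n))\<^sup>2)"
        using order_trans[OF below R[of n]] by simp
      then have "(dist b (z n))\<^sup>2 \<le> 2 * (G n - L) + (dist a (z n))\<^sup>2 - (dist a b)\<^sup>2"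
        by (simp add: field_simps)
      then show ?case using elim by argo
    qed
  qed
  moreover have "(asymptotic_radius z a)\<^sup>2 \<le> (asymptotic_radius z b)\<^sup>2"
    using a asymptotic_radius_nonneg[OF bdd]
    by (intro power_mono) (auto simp: asymptotic_center_iff[OF bdd])
  ultimately have "(dist a b)\<^sup>2 \<le> 0" by linarith
  then have "b = a" by simp
  then have "g a \<le> ereal (G n)" for n using R[of n] by simp
  then show ?thesis
    using G(2) by (intro LIMSEQ_le_const[of "\<lambda>n. ereal (G n)"]) (auto intro: tendsto_ereal)
qed

section \<open>Convergence of the orbit\<close>

text \<open>
  At a point of \<open>C\<close> the radius of \<open>x\<close> equals that of each subsequence, because the distances
  converge. So the center of a subsequence, which lies in \<open>C\<close>, cannot beat the center \<open>a\<close> of the full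
  sequence, and by uniqueness it is \<open>a\<close>.
\<close>

lemma Fejer_Delta_convergent:
  fixes x :: "nat \<Rightarrow> 'a::hadamard_space"
  assumes bdd: "bounded (range x)"
    and conv: "\<And>p. p \<in> C \<Longrightarrow> convergent (\<lambda>n. dist p (x n))"
    and centers: "\<And>r. strict_mono r \<Longrightarrow> asymptotic_center (x \<circ> r) \<subseteq> C"
  shows "\<exists>z\<in>C. Delta_convergent x z"
proof -
  have sub: "bounded (range (x \<circ> r))" for r :: "nat \<Rightarrow> nat"
    using bdd by (rule bounded_subset) auto
  obtain a where a: "asymptotic_center x = {a}" using asymptotic_center_singleton[OF bdd] by blast
  have "a \<in> C" using centers[of id] a by (simp add: strict_mono_id)
  have const: "limsup (\<lambda>n. ereal (dist p ((x \<circ> r) n))) = limsup (\<lambda>n. ereal (dist p (x n)))"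
    if p: "p \<in> C" and r: "strict_mono r" for p r
  proof -
    obtain l where l: "(\<lambda>n. dist p (x n)) \<longlonglongrightarrow> l" using conv[OF p] by (auto simp: convergent_def)
    have "(\<lambda>n. dist p ((x \<circ> r) n)) \<longlonglongrightarrow> l"
      using LIMSEQ_subseq_LIMSEQ[OF l r] by (simp add: o_def)
    from lim_imp_Limsup[OF _ tendsto_ereal[OF this]] lim_imp_Limsup[OF _ tendsto_ereal[OF l]]
    show ?thesis by simp
  qed
  have "asymptotic_center (x \<circ> r) = {a}" if r: "strict_mono r" for r
  proof -
    obtain b where b: "asymptotic_center (x \<circ> r) = {b}"
      using asymptotic_center_singleton[OF sub] by blast
    then have "b \<in> C" using centers[OF r] by simp
    have eq: "asymptotic_radius (x \<circ> r) p = asymptotic_radius x p" if "p \<in> C" for p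
      unfolding asymptotic_radius_def const[OF that r] ..
    have "asymptotic_radius x a \<le> asymptotic_radius x b"
      using a asymptotic_center_iff[OF bdd] by blast
    then have "asymptotic_radius (x \<circ> r) a \<le> asymptotic_radius (x \<circ> r) b"
      using eq \<open>a \<in> C\<close> \<open>b \<in> C\<close> by simp
    also have "\<dots> \<le> asymptotic_radius (x \<circ> r) y" for y
      using b asymptotic_center_iff[OF sub, of b r] by simp
    finally have "a \<in> asymptotic_center (x \<circ> r)"
      by (simp add: asymptotic_center_iff[OF sub])
    then show ?thesis using b by simp
  qed
  then show ?thesis using \<open>a \<in> C\<close> bdd by (auto simp: Delta_convergent_def)
qed

lemma resolvent_product_0 [simp]: "resolvent_product 0 lam f x = x"
  by (simp add: resolvent_product_def)

lemma resolvent_product_Suc [simp]: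
  "resolvent_product (Suc k) lam f x
    = resolvent (lam (Suc k)) (f (Suc k)) (resolvent_product k lam f x)"
  by (simp add: resolvent_product_def)

theorem corollary3:
  fixes m :: nat and lam :: "nat \<Rightarrow> real"
    and f :: "nat \<Rightarrow> 'a::hadamard_space \<Rightarrow> ereal" and x0 :: 'a
  assumes "m \<ge> 1"
    and "\<And>i. i \<in> {1..m} \<Longrightarrow> proper_fun (f i)"
    and "\<And>i. i \<in> {1..m} \<Longrightarrow> lower_semicontinuous (f i)"
    and "\<And>i. i \<in> {1..m} \<Longrightarrow> geodesically_convex (f i)"
    and "\<And>i. i \<in> {1..m} \<Longrightarrow> lam i > 0"
    and "(\<Inter>i\<in>{1..m}. argmin_set (f i)) \<noteq> {}"
  shows "\<exists>xstar \<in> argmin_set (\<lambda>x. \<Sum>i=1..m. f i x).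
    Delta_convergent (\<lambda>n. (resolvent_product m lam f ^^ n) x0) xstar"
proof -
  define C where "C = (\<Inter>i\<in>{1..m}. argmin_set (f i))"
  \<comment> \<open>\<open>S k (x n)\<close> is the point reached after the first \<open>k\<close> resolvents of the \<open>n\<close>-th sweep.\<close>
  define S where "S k = resolvent_product k lam f" for k
  define x where "x n = (S m ^^ n) x0" for n
  have x_Suc: "x (Suc n) = S m (x n)" for n by (simp add: x_def)
  obtain p0 where "p0 \<in> C" using assms(6) C_def by blast
  have "\<exists>L. f i p0 = ereal L" if "i \<in> {1..m}" for i
  proof -
    have "f i p0 \<le> f i y" for y using \<open>p0 \<in> C\<close> that by (auto simp: C_def argmin_set_iff)
    then have "f i p0 \<noteq> \<infinity>" using assms(2)[OF that] by (force simp: proper_fun_def)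
    moreover have "f i p0 \<noteq> -\<infinity>" using assms(2)[OF that] by (simp add: proper_fun_def)
    ultimately show ?thesis by (cases "f i p0") auto
  qed
  then obtain L where L: "\<And>i. i \<in> {1..m} \<Longrightarrow> f i p0 = ereal (L i)" by metis
  have below: "ereal (L i) \<le> f i y" if "i \<in> {1..m}" for i y
  proof -
    have "p0 \<in> argmin_set (f i)" using \<open>p0 \<in> C\<close> that unfolding C_def by blast
    then have "f i p0 \<le> f i y" by (simp add: argmin_set_iff)
    then show ?thesis by (simp add: L[OF that])
  qed
  have C_iff: "p \<in> C \<longleftrightarrow> (\<forall>i\<in>{1..m}. f i p \<le> ereal (L i))" for p
  proof -
    have "p \<in> argmin_set (f i) \<longleftrightarrow> f i p \<le> ereal (L i)" if "i \<in> {1..m}" for i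
    proof
      assume "p \<in> argmin_set (f i)"
      then have "f i p \<le> f i p0" by (simp add: argmin_set_iff)
      then show "f i p \<le> ereal (L i)" by (simp add: L[OF that])
    next
      assume "f i p \<le> ereal (L i)"
      then have "f i p \<le> f i y" for y using below[OF that] by (rule order_trans)
      then show "p \<in> argmin_set (f i)" by (simp add: argmin_set_iff)
    qed
    then show ?thesis by (simp add: C_def)
  qed
  have step: "f (Suc k) (S (Suc k) y) \<le> ereal (L (Suc k) + 1 / (2 * lam (Suc k)) *
      ((dist p (S k y))\<^sup>2 - (dist (S k y) (S (Suc k) y))\<^sup>2 - (dist p (S (Suc k) y))\<^sup>2))"
    if "p \<in> C" "k < m" for p k y
  proof -
    have i: "Suc k \<in> {1..m}" using that by auto
    have "f (Suc k) p \<le> ereal (L (Suc k))" using that i by (simp add: C_iff)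
    from resolvent_inequality[OF assms(3,4)[OF i] below[OF i] assms(5)[OF i] this, of _ "S k y"]
    show ?thesis by (simp add: S_def dist_commute)
  qed
  have dec: "(dist (S k y) (S (Suc k) y))\<^sup>2 \<le> (dist p (S k y))\<^sup>2 - (dist p (S (Suc k) y))\<^sup>2"
    if "p \<in> C" "k < m" for p k y
  proof -
    have i: "Suc k \<in> {1..m}" using that by auto
    have "0 \<le> 1 / (2 * lam (Suc k)) *
      ((dist p (S k y))\<^sup>2 - (dist (S k y) (S (Suc k) y))\<^sup>2 - (dist p (S (Suc k) y))\<^sup>2)"
      using order_trans[OF below[OF i] step[OF that]] by simp
    then show ?thesis using assms(5)[OF i] by (simp add: zero_le_divide_iff)
  qed
  have mono: "dist p (S l y) \<le> dist p (S k y)" if "p \<in> C" "k \<le> l" "l \<le> m" for p k l y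
    using \<open>k \<le> l\<close> \<open>l \<le> m\<close>
  proof (induction l rule: dec_induct)
    case (step l)
    have "(dist p (S (Suc l) y))\<^sup>2 \<le> (dist p (S l y))\<^sup>2"
      using dec[OF \<open>p \<in> C\<close>, of l y] step.prems zero_le_power2[of "dist (S l y) (S (Suc l) y)"]
      by linarith
    then have "dist p (S (Suc l) y) \<le> dist p (S l y)" by (rule power2_le_imp_le) simp
    then show ?case using step by simp
  qed simp
  have S0: "S 0 y = y" for y by (simp add: S_def)
  have Fejer: "decseq (\<lambda>n. dist p (x n))" if "p \<in> C" for p
    using mono[OF that, of 0 m] by (intro decseq_SucI) (simp add: x_Suc S0)
  have conv: "convergent (\<lambda>n. dist p (x n))" if "p \<in> C" for p
    using decseq_convergent[OF Fejer[OF that], of 0] zero_le_dist unfolding convergent_def by metis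
  have bdd: "bounded (range x)"
    unfolding bounded_def using decseqD[OF Fejer[OF \<open>p0 \<in> C\<close>], of 0] by blast
  obtain d where d: "(\<lambda>n. dist p0 (x n)) \<longlonglongrightarrow> d"
    using conv[OF \<open>p0 \<in> C\<close>] by (auto simp: convergent_def)
  \<comment> \<open>Intermediate points are squeezed between \<open>x n\<close> and \<open>x (Suc n)\<close> in their distance to \<open>p0\<close>.\<close>
  have stage: "(\<lambda>n. dist p0 (S k (x n))) \<longlonglongrightarrow> d" if "k \<le> m" for k
  proof (rule tendsto_sandwich[OF _ _ LIMSEQ_Suc[OF d] d])
    show "\<forall>\<^sub>F n in sequentially. dist p0 (x (Suc n)) \<le> dist p0 (S k (x n))"
      using mono[OF \<open>p0 \<in> C\<close> that] by (simp add: x_Suc)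
    show "\<forall>\<^sub>F n in sequentially. dist p0 (S k (x n)) \<le> dist p0 (x n)"
      using mono[OF \<open>p0 \<in> C\<close> _ that, of 0] by (simp add: S0)
  qed
  have gap: "(\<lambda>n. (dist p0 (S k (x n)))\<^sup>2 - (dist p0 (S (Suc k) (x n)))\<^sup>2) \<longlonglongrightarrow> 0" if "k < m" for k
  proof -
    have "(\<lambda>n. (dist p0 (S k (x n)))\<^sup>2 - (dist p0 (S (Suc k) (x n)))\<^sup>2) \<longlonglongrightarrow> d\<^sup>2 - d\<^sup>2"
      using that by (intro tendsto_intros stage) auto
    then show ?thesis by simp
  qed
  have jump: "(\<lambda>n. (dist (S k (x n)) (S (Suc k) (x n)))\<^sup>2) \<longlonglongrightarrow> 0" if "k < m" for k
    using dec[OF \<open>p0 \<in> C\<close> that] by (intro Lim_null_comparison[OF _ gap[OF that]]) simp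
  have near: "(\<lambda>n. dist (x n) (S k (x n))) \<longlonglongrightarrow> 0" if "k \<le> m" for k
    using that
  proof (induction k)
    case (Suc k)
    have "(\<lambda>n. sqrt ((dist (S k (x n)) (S (Suc k) (x n)))\<^sup>2)) \<longlonglongrightarrow> sqrt 0"
      using Suc.prems by (intro tendsto_real_sqrt jump) simp
    then have "(\<lambda>n. dist (x n) (S k (x n)) + dist (S k (x n)) (S (Suc k) (x n))) \<longlonglongrightarrow> 0 + 0"
      using Suc by (intro tendsto_add) auto
    then have sum: "(\<lambda>n. dist (x n) (S k (x n)) + dist (S k (x n)) (S (Suc k) (x n))) \<longlonglongrightarrow> 0"
      by simp
    show ?case
      by (rule Lim_null_comparison[OF _ sum]) (simp add: dist_triangle)
  qed (simp add: S0)
  have centers: "asymptotic_center (x \<circ> r) \<subseteq> C" if r: "strict_mono r" for r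
  proof
    fix a assume a: "a \<in> asymptotic_center (x \<circ> r)"
    have "f i a \<le> ereal (L i)" if i: "i \<in> {1..m}" for i
    proof -
      obtain k where k: "i = Suc k" "k < m" using i by (cases i) auto
      define z where "z n = S i (x (r n))" for n
      \<comment> \<open>The bound on \<open>f i (S i (x n))\<close> given by \<open>step\<close>; it tends to the minimum of \<open>f i\<close>.\<close>
      define G where "G n = L i + 1 / (2 * lam i) *
        ((dist p0 (S k (x n)))\<^sup>2 - (dist p0 (S (Suc k) (x n)))\<^sup>2 -
          (dist (S k (x n)) (S (Suc k) (x n)))\<^sup>2)" for n
      have "G \<longlonglongrightarrow> L i + 1 / (2 * lam i) * (0 - 0)"
        unfolding G_def using k(2) by (intro tendsto_intros gap jump)
      then have "(G \<circ> r) \<longlonglongrightarrow> L i" using r by (auto intro: LIMSEQ_subseq_LIMSEQ)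
      moreover have "f i (z n) \<le> ereal ((G \<circ> r) n)" for n
        using step[OF \<open>p0 \<in> C\<close> k(2), of "x (r n)"]
        by (simp add: z_def G_def k(1) algebra_simps)
      moreover have "bounded (range z)"
        unfolding bounded_def
      proof (intro exI ballI)
        fix w assume "w \<in> range z"
        then obtain n where "w = S i (x (r n))" by (auto simp: z_def)
        then show "dist p0 w \<le> dist p0 (x 0)"
          using mono[OF \<open>p0 \<in> C\<close>, of 0 i "x (r n)"] decseqD[OF Fejer[OF \<open>p0 \<in> C\<close>], of 0 "r n"] i
          by (simp add: S0)
      qed
      moreover have "(\<lambda>n. dist ((x \<circ> r) n) (z n)) \<longlonglongrightarrow> 0"
        using LIMSEQ_subseq_LIMSEQ[OF near r, of i] i by (simp add: o_def z_def)
      then have "a \<in> asymptotic_center z" using a asymptotic_center_cong by blast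
      ultimately show ?thesis
        by (intro asymptotic_center_minimizing_sequence[OF assms(3,4)[OF i] below[OF i]])
    qed
    then show "a \<in> C" by (simp add: C_iff)
  qed
  obtain a where "a \<in> C" "Delta_convergent x a"
    using Fejer_Delta_convergent[OF bdd conv centers] by blast
  moreover have "a \<in> argmin_set (\<lambda>x. \<Sum>i=1..m. f i x)"
    using \<open>a \<in> C\<close> by (auto simp: C_def argmin_set_iff intro: sum_mono)
  ultimately show ?thesis unfolding x_def S_def by blast
qed

end
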